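(* Let $\mathsf{JL}$ be one of the justification logics $\mathsf{J},\mathsf{J4},\mathsf{JD},\mathsf{JD4},\mathsf{JT},\mathsf{LP}$, and let $\mathsf{CS}$ be a finite constant specification for $\mathsf{JL}$. Every sequent $\Gamma\Rightarrow\Delta$ in the language of $\mathsf{G3JL}$ is either derivable in $\mathsf{G3JL}_{\mathsf{CS}}$ or has a $\mathsf{JL}_{\mathsf{CS}}$-countermodel.
   Context: Justification logics. Terms are built from justification variables and constants by binary $\cdot,+$ and, if (j4) is an axiom, unary $!$. Formulas are built from propositional variables and $\bot$ by $\neg,\wedge,\vee,\to$ and $t:A$. $Tm$, $Fm$ are the sets of terms and formulas. $\mathsf J$ has axiom schemes: propositional tautologies; $s:A\to(s+t):A$, $s:A\to(t+s):A$; $s:(A\to B)\to(t:A\to(s\cdot t):B)$. Further schemes: (jT) $t:A\to A$, (jD) $t:\bot\to\bot$, (j4) $t:A\to\,!t:t:A$. The names list the added schemes, $\mathsf{LP}=\mathsf{JT4}$. A constant specification $\mathsf{CS}$: if (j4) is not an axiom, a set of formulas $c_n:\dots:c_1:A$ ($n\ge1$, $c_j$ constants, $A$ an axiom instance), closed under passing from $c_n:c_{n-1}:\dots:c_1:A$ to $c_{n-1}:\dots:c_1:A$; if (j4) is an axiom, a set of formulas $c:A$ ($c$ a constant, $A$ an axiom instance). Models. A $\mathsf{JL}_{\mathsf{CS}}$-model (Fitting model) is $\mathcal M=(\mathcal W,\mathcal R,\mathcal E,\mathcal V)$ with $\mathcal W\neq\emptyset$, $\mathcal R\subseteq\mathcal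 W\times\mathcal W$, $\mathcal V$ a map from propositional variables to subsets of $\mathcal W$, and $\mathcal E:Tm\times Fm\to2^{\mathcal W}$ with $\mathcal E(c,F)=\mathcal W$ for each $c:F\in\mathsf{CS}$. Forcing: $(\mathcal M,w)\Vdash P$ iff $w\in\mathcal V(P)$; Boolean connectives are classical; $(\mathcal M,w)\Vdash t:F$ iff $w\in\mathcal E(t,F)$ and $(\mathcal M,v)\Vdash F$ for all $v$ with $w\mathcal Rv$. Conditions: $\mathcal E(s,A\to B)\cap\mathcal E(t,A)\subseteq\mathcal E(s\cdot t,B)$; $\mathcal E(s,A)\cup\mathcal E(t,A)\subseteq\mathcal E(s+t,A)$; if (jT) is an axiom, $\mathcal R$ is reflexive; if (jD), $\mathcal R$ is serial; if (j4), $\mathcal R$ is transitive, $w\in\mathcal E(t,A)$ and $w\mathcal Rv$ imply $v\in\mathcal E(t,A)$, and $\mathcal E(t,A)\subseteq\mathcal E(!t,t:A)$. Calculus $\mathsf{G3JL}_{\mathsf{CS}}$. Fix a countably infinite set $L$ of labels $w,v,u,\dots$. The labeled language has labeled formulas $w\Vvdash A$, relational atoms $wRv$ and evidence atoms $wE(t,A)$ ($A$ a formula, $t$ a term). Sequents $\Gamma\Rightarrow\Delta$ consist of finite multisets of these. Initial sequents: $w\Vvdash P,\Gamma\Rightarrow\Delta,w\Vvdash P$ ($P$ a propositional variable); $w\Vvdash\bot,\Gamma\Rightarrow\Delta$; $wRv,\Gamma\Rightarrow\Delta,wRv$; $wE(t,A),\Gamma\Rightarrow\Delta,wE(t,A)$.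 Rules (premises / conclusion): (L$\neg$) $\Gamma\Rightarrow\Delta,w\Vvdash A$ / $w\Vvdash\neg A,\Gamma\Rightarrow\Delta$; (R$\neg$) $w\Vvdash A,\Gamma\Rightarrow\Delta$ / $\Gamma\Rightarrow\Delta,w\Vvdash\neg A$; (L$\wedge$) $w\Vvdash A,w\Vvdash B,\Gamma\Rightarrow\Delta$ / $w\Vvdash A\wedge B,\Gamma\Rightarrow\Delta$; (R$\wedge$) $\Gamma\Rightarrow\Delta,w\Vvdash A$ and $\Gamma\Rightarrow\Delta,w\Vvdash B$ / $\Gamma\Rightarrow\Delta,w\Vvdash A\wedge B$; (L$\vee$) $w\Vvdash A,\Gamma\Rightarrow\Delta$ and $w\Vvdash B,\Gamma\Rightarrow\Delta$ / $w\Vvdash A\vee B,\Gamma\Rightarrow\Delta$; (R$\vee$) $\Gamma\Rightarrow\Delta,w\Vvdash A,w\Vvdash B$ / $\Gamma\Rightarrow\Delta,w\Vvdash A\vee B$; (L$\to$) $\Gamma\Rightarrow\Delta,w\Vvdash A$ and $w\Vvdash B,\Gamma\Rightarrow\Delta$ / $w\Vvdash A\to B,\Gamma\Rightarrow\Delta$; (R$\to$) $w\Vvdash A,\Gamma\Rightarrow\Delta,w\Vvdash B$ / $\Gamma\Rightarrow\Delta,w\Vvdash A\to B$; (L:) $v\Vvdash A,w\Vvdash t:A,wRv,\Gamma\Rightarrow\Delta$ / $w\Vvdash t:A,wRv,\Gamma\Rightarrow\Delta$; (R:) $wRv,wE(t,A),\Gamma\Rightarrow\Delta,v\Vvdash A$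 / $wE(t,A),\Gamma\Rightarrow\Delta,w\Vvdash t:A$, where the eigenlabel $v$ does not occur in the conclusion; (E) $wE(t,A),w\Vvdash t:A,\Gamma\Rightarrow\Delta$ / $w\Vvdash t:A,\Gamma\Rightarrow\Delta$; (El+) $wE(s+t,A),wE(t,A),\Gamma\Rightarrow\Delta$ / $wE(t,A),\Gamma\Rightarrow\Delta$; (Er+) $wE(t+s,A),wE(t,A),\Gamma\Rightarrow\Delta$ / $wE(t,A),\Gamma\Rightarrow\Delta$; (E$\cdot$) $wE(s\cdot t,B),wE(s,A\to B),wE(t,A),\Gamma\Rightarrow\Delta$ / $wE(s,A\to B),wE(t,A),\Gamma\Rightarrow\Delta$; (IAN)/(AN) $wE(c,F),\Gamma\Rightarrow\Delta$ / $\Gamma\Rightarrow\Delta$, for $c:F\in\mathsf{CS}$ ($c$ a constant). If (jT) is an axiom: (Ref) $wRw,\Gamma\Rightarrow\Delta$ / $\Gamma\Rightarrow\Delta$. If (jD) is an axiom: (Ser) $wRv,\Gamma\Rightarrow\Delta$ / $\Gamma\Rightarrow\Delta$, where the eigenlabel $v$ does not occur in the conclusion. If (j4) is an axiom: (E!) $wE(!t,t:A),wE(t,A),\Gamma\Rightarrow\Delta$ / $wE(t,A),\Gamma\Rightarrow\Delta$; (Mon) $vE(t,A),wE(t,A),wRv,\Gamma\Rightarrow\Delta$ / $wE(t,A),wRv,\Gamma\Rightarrow\Delta$; (Trans) $wRu,wRv,vRu,\Gamma\Rightarrow\Delta$ / $wRv,vRu,\Gamma\Rightarrow\Delta$. Countermodels.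 An $\mathcal M$-interpretation is a function $[\cdot]:L\to\mathcal W$. It validates $w\Vvdash A$ if $(\mathcal M,[w])\Vdash A$, validates $wRv$ if $[w]\mathcal R[v]$, and validates $wE(t,A)$ if $[w]\in\mathcal E(t,A)$. A $\mathsf{JL}_{\mathsf{CS}}$-countermodel for $\Gamma\Rightarrow\Delta$ is a $\mathsf{JL}_{\mathsf{CS}}$-model $\mathcal M$ for which some $\mathcal M$-interpretation validates all formulas of $\Gamma$ and no formula of $\Delta$. *)

theory Defs
  imports Main "HOL-Library.Multiset"
begin

datatype logic = J | J4 | JD | JD4 | JT | LP

definition has_jT :: "logic \<Rightarrow> bool" where
  "has_jT JL \<longleftrightarrow> JL \<in> {JT, LP}"

definition has_jD :: "logic \<Rightarrow> bool" where
  "has_jD JL \<longleftrightarrow> JL \<in> {JD, JD4}"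

definition has_j4 :: "logic \<Rightarrow> bool" where
  "has_j4 JL \<longleftrightarrow> JL \<in> {J4, JD4, LP}"

text \<open>The type parameters are the propositional variables, the justification variables and the
  constants; no cardinality assumption is made on them.\<close>

datatype ('x, 'c) tm =
    JVar 'x
  | Const 'c
  | App "('x, 'c) tm" "('x, 'c) tm"
  | Plus "('x, 'c) tm" "('x, 'c) tm"
  | Bang "('x, 'c) tm"

datatype ('p, 'x, 'c) fm =
    Atom 'p
  | Bot
  | Neg "('p, 'x, 'c) fm"
  | And "('p, 'x, 'c) fm" "('p, 'x, 'c) fm"
  | Or "('p, 'x, 'c) fm" "('p, 'x, 'c) fm"
  | Imp "('p, 'x, 'c) fm" "('p, 'x, 'c) fm"
  | Just "('x, 'c) tm" "('p, 'x, 'c) fm"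

text \<open>The datatypes contain \<open>Bang\<close> for every logic; \<open>Tm JL\<close> and \<open>Fm JL\<close> are the terms and formulas
  of the language of \<open>JL\<close>, where \<open>Bang\<close> is available only if (j4) is an axiom.\<close>

primrec tm_in :: "logic \<Rightarrow> ('x, 'c) tm \<Rightarrow> bool" where
  "tm_in JL (JVar x) \<longleftrightarrow> True"
| "tm_in JL (Const c) \<longleftrightarrow> True"
| "tm_in JL (App s t) \<longleftrightarrow> tm_in JL s \<and> tm_in JL t"
| "tm_in JL (Plus s t) \<longleftrightarrow> tm_in JL s \<and> tm_in JL t"
| "tm_in JL (Bang t) \<longleftrightarrow> has_j4 JL \<and> tm_in JL t"

primrec fm_in :: "logic \<Rightarrow> ('p, 'x, 'c) fm \<Rightarrow> bool" where
  "fm_in JL (Atom p) \<longleftrightarrow> True"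
| "fm_in JL Bot \<longleftrightarrow> True"
| "fm_in JL (Neg A) \<longleftrightarrow> fm_in JL A"
| "fm_in JL (And A B) \<longleftrightarrow> fm_in JL A \<and> fm_in JL B"
| "fm_in JL (Or A B) \<longleftrightarrow> fm_in JL A \<and> fm_in JL B"
| "fm_in JL (Imp A B) \<longleftrightarrow> fm_in JL A \<and> fm_in JL B"
| "fm_in JL (Just t A) \<longleftrightarrow> tm_in JL t \<and> fm_in JL A"

definition Tm :: "logic \<Rightarrow> ('x, 'c) tm set" where
  "Tm JL = {t. tm_in JL t}"

definition Fm :: "logic \<Rightarrow> ('p, 'x, 'c) fm set" where
  "Fm JL = {A. fm_in JL A}"

text \<open>Propositional evaluation: formulas \<open>t:A\<close> are treated as atoms, with truth values given by \<open>g\<close>.\<close>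

primrec peval :: "('p \<Rightarrow> bool) \<Rightarrow> (('x, 'c) tm \<Rightarrow> ('p, 'x, 'c) fm \<Rightarrow> bool) \<Rightarrow> ('p, 'x, 'c) fm \<Rightarrow> bool" where
  "peval f g (Atom p) \<longleftrightarrow> f p"
| "peval f g Bot \<longleftrightarrow> False"
| "peval f g (Neg A) \<longleftrightarrow> \<not> peval f g A"
| "peval f g (And A B) \<longleftrightarrow> peval f g A \<and> peval f g B"
| "peval f g (Or A B) \<longleftrightarrow> peval f g A \<or> peval f g B"
| "peval f g (Imp A B) \<longleftrightarrow> (peval f g A \<longrightarrow> peval f g B)"
| "peval f g (Just t A) \<longleftrightarrow> g t A"

definition tautology :: "('p, 'x, 'c) fm \<Rightarrow> bool" where
  "tautology A \<longleftrightarrow> (\<forall>f g. peval f g A)"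

inductive axiom_scheme :: "logic \<Rightarrow> ('p, 'x, 'c) fm \<Rightarrow> bool" for JL where
  Taut: "tautology A \<Longrightarrow> axiom_scheme JL A"
| SumL: "axiom_scheme JL (Imp (Just s A) (Just (Plus s t) A))"
| SumR: "axiom_scheme JL (Imp (Just s A) (Just (Plus t s) A))"
| Appl: "axiom_scheme JL (Imp (Just s (Imp A B)) (Imp (Just t A) (Just (App s t) B)))"
| jT: "has_jT JL \<Longrightarrow> axiom_scheme JL (Imp (Just t A) A)"
| jD: "has_jD JL \<Longrightarrow> axiom_scheme JL (Imp (Just t Bot) Bot)"
| j4: "has_j4 JL \<Longrightarrow> axiom_scheme JL (Imp (Just t A) (Just (Bang t) (Just t A)))"

definition axiom_instances :: "logic \<Rightarrow> ('p, 'x, 'c) fm set" where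
  "axiom_instances JL = {A \<in> Fm JL. axiom_scheme JL A}"

text \<open>\<open>const_prefix [c\<^sub>n, \<dots>, c\<^sub>1] A\<close> is \<open>c\<^sub>n:\<dots>:c\<^sub>1:A\<close>.\<close>

definition const_prefix :: "'c list \<Rightarrow> ('p, 'x, 'c) fm \<Rightarrow> ('p, 'x, 'c) fm" where
  "const_prefix cs A = foldr (\<lambda>c F. Just (Const c) F) cs A"

definition constant_spec :: "logic \<Rightarrow> ('p, 'x, 'c) fm set \<Rightarrow> bool" where
  "constant_spec JL CS \<longleftrightarrow>
    (if has_j4 JL
     then CS \<subseteq> {Just (Const c) A | c A. A \<in> axiom_instances JL}
     else CS \<subseteq> {const_prefix cs A | cs A. cs \<noteq> [] \<and> A \<in> axiom_instances JL} \<and>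
          (\<forall>c cs A. cs \<noteq> [] \<longrightarrow> A \<in> axiom_instances JL \<longrightarrow>
             const_prefix (c # cs) A \<in> CS \<longrightarrow> const_prefix cs A \<in> CS))"

record ('p, 'x, 'c, 'w) model =
  worlds :: "'w set"
  acc :: "('w \<times> 'w) set"
  evid :: "('x, 'c) tm \<Rightarrow> ('p, 'x, 'c) fm \<Rightarrow> 'w set"
  val :: "'p \<Rightarrow> 'w set"

primrec forces :: "('p, 'x, 'c, 'w) model \<Rightarrow> 'w \<Rightarrow> ('p, 'x, 'c) fm \<Rightarrow> bool" where
  "forces M w (Atom p) \<longleftrightarrow> w \<in> val M p"
| "forces M w Bot \<longleftrightarrow> False"
| "forces M w (Neg A) \<longleftrightarrow> \<not> forces M w A"
| "forces M w (And A B) \<longleftrightarrow> forces M w A \<and> forces M w B"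
| "forces M w (Or A B) \<longleftrightarrow> forces M w A \<or> forces M w B"
| "forces M w (Imp A B) \<longleftrightarrow> (forces M w A \<longrightarrow> forces M w B)"
| "forces M w (Just t A) \<longleftrightarrow> w \<in> evid M t A \<and> (\<forall>v. (w, v) \<in> acc M \<longrightarrow> forces M v A)"

text \<open>The evidence function is constrained only on \<open>Tm JL \<times> Fm JL\<close>; its values elsewhere are
  irrelevant, since forcing of formulas in \<open>Fm JL\<close> does not depend on them.\<close>

definition fitting_model :: "logic \<Rightarrow> ('p, 'x, 'c) fm set \<Rightarrow> ('p, 'x, 'c, 'w) model \<Rightarrow> bool" where
  "fitting_model JL CS M \<longleftrightarrow>
     worlds M \<noteq> {} \<and>
     acc M \<subseteq> worlds M \<times> worlds M \<and>
     (\<forall>p. val M p \<subseteq> worlds M) \<and>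
     (\<forall>t\<in>Tm JL. \<forall>A\<in>Fm JL. evid M t A \<subseteq> worlds M) \<and>
     (\<forall>c F. Just (Const c) F \<in> CS \<longrightarrow> evid M (Const c) F = worlds M) \<and>
     (\<forall>s\<in>Tm JL. \<forall>t\<in>Tm JL. \<forall>A\<in>Fm JL. \<forall>B\<in>Fm JL.
        evid M s (Imp A B) \<inter> evid M t A \<subseteq> evid M (App s t) B) \<and>
     (\<forall>s\<in>Tm JL. \<forall>t\<in>Tm JL. \<forall>A\<in>Fm JL.
        evid M s A \<union> evid M t A \<subseteq> evid M (Plus s t) A) \<and>
     (has_jT JL \<longrightarrow> refl_on (worlds M) (acc M)) \<and>
     (has_jD JL \<longrightarrow> (\<forall>w\<in>worlds M. \<exists>v\<in>worlds M. (w, v) \<in> acc M)) \<and>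
     (has_j4 JL \<longrightarrow>
        trans (acc M) \<and>
        (\<forall>t\<in>Tm JL. \<forall>A\<in>Fm JL. \<forall>w v. w \<in> evid M t A \<longrightarrow> (w, v) \<in> acc M \<longrightarrow> v \<in> evid M t A) \<and>
        (\<forall>t\<in>Tm JL. \<forall>A\<in>Fm JL. evid M t A \<subseteq> evid M (Bang t) (Just t A)))"

type_synonym label = nat

datatype ('p, 'x, 'c) lfm =
    Frc label "('p, 'x, 'c) fm"
  | Rel label label
  | Ev label "('x, 'c) tm" "('p, 'x, 'c) fm"

primrec lfm_in :: "logic \<Rightarrow> ('p, 'x, 'c) lfm \<Rightarrow> bool" where
  "lfm_in JL (Frc w A) \<longleftrightarrow> A \<in> Fm JL"
| "lfm_in JL (Rel w v) \<longleftrightarrow> True"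
| "lfm_in JL (Ev w t A) \<longleftrightarrow> t \<in> Tm JL \<and> A \<in> Fm JL"

primrec lfm_labels :: "('p, 'x, 'c) lfm \<Rightarrow> label set" where
  "lfm_labels (Frc w A) = {w}"
| "lfm_labels (Rel w v) = {w, v}"
| "lfm_labels (Ev w t A) = {w}"

definition in_language :: "logic \<Rightarrow> ('p, 'x, 'c) lfm multiset \<Rightarrow> bool" where
  "in_language JL \<Gamma> \<longleftrightarrow> (\<forall>\<phi>\<in>#\<Gamma>. lfm_in JL \<phi>)"

definition labels :: "('p, 'x, 'c) lfm multiset \<Rightarrow> label set" where
  "labels \<Gamma> = (\<Union>\<phi>\<in>set_mset \<Gamma>. lfm_labels \<phi>)"

text \<open>\<open>G3 JL CS \<Gamma> \<Delta>\<close>: the sequent \<open>\<Gamma> \<Rightarrow> \<Delta>\<close> is derivable. Only the initial sequents carry an explicit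
  restriction to the language of \<open>JL\<close>: every rule's premises contain all terms and formulas of
  its conclusion, so the restriction propagates to whole derivations (lemma \<open>G3_in_language\<close>).
  (IAN) and (AN) are both \<open>AN\<close>.\<close>

inductive G3 :: "logic \<Rightarrow> ('p, 'x, 'c) fm set \<Rightarrow>
    ('p, 'x, 'c) lfm multiset \<Rightarrow> ('p, 'x, 'c) lfm multiset \<Rightarrow> bool" for JL CS where
  InitP: "in_language JL \<Gamma> \<Longrightarrow> in_language JL \<Delta> \<Longrightarrow>
    G3 JL CS (add_mset (Frc w (Atom P)) \<Gamma>) (add_mset (Frc w (Atom P)) \<Delta>)"
| InitBot: "in_language JL \<Gamma> \<Longrightarrow> in_language JL \<Delta> \<Longrightarrow>
    G3 JL CS (add_mset (Frc w Bot) \<Gamma>) \<Delta>"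
| InitR: "in_language JL \<Gamma> \<Longrightarrow> in_language JL \<Delta> \<Longrightarrow>
    G3 JL CS (add_mset (Rel w v) \<Gamma>) (add_mset (Rel w v) \<Delta>)"
| InitE: "in_language JL \<Gamma> \<Longrightarrow> in_language JL \<Delta> \<Longrightarrow> t \<in> Tm JL \<Longrightarrow> A \<in> Fm JL \<Longrightarrow>
    G3 JL CS (add_mset (Ev w t A) \<Gamma>) (add_mset (Ev w t A) \<Delta>)"
| LNeg: "G3 JL CS \<Gamma> (add_mset (Frc w A) \<Delta>) \<Longrightarrow>
    G3 JL CS (add_mset (Frc w (Neg A)) \<Gamma>) \<Delta>"
| RNeg: "G3 JL CS (add_mset (Frc w A) \<Gamma>) \<Delta> \<Longrightarrow>
    G3 JL CS \<Gamma> (add_mset (Frc w (Neg A)) \<Delta>)"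
| LAnd: "G3 JL CS (add_mset (Frc w A) (add_mset (Frc w B) \<Gamma>)) \<Delta> \<Longrightarrow>
    G3 JL CS (add_mset (Frc w (And A B)) \<Gamma>) \<Delta>"
| RAnd: "G3 JL CS \<Gamma> (add_mset (Frc w A) \<Delta>) \<Longrightarrow> G3 JL CS \<Gamma> (add_mset (Frc w B) \<Delta>) \<Longrightarrow>
    G3 JL CS \<Gamma> (add_mset (Frc w (And A B)) \<Delta>)"
| LOr: "G3 JL CS (add_mset (Frc w A) \<Gamma>) \<Delta> \<Longrightarrow> G3 JL CS (add_mset (Frc w B) \<Gamma>) \<Delta> \<Longrightarrow>
    G3 JL CS (add_mset (Frc w (Or A B)) \<Gamma>) \<Delta>"
| ROr: "G3 JL CS \<Gamma> (add_mset (Frc w A) (add_mset (Frc w B) \<Delta>)) \<Longrightarrow>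
    G3 JL CS \<Gamma> (add_mset (Frc w (Or A B)) \<Delta>)"
| LImp: "G3 JL CS \<Gamma> (add_mset (Frc w A) \<Delta>) \<Longrightarrow> G3 JL CS (add_mset (Frc w B) \<Gamma>) \<Delta> \<Longrightarrow>
    G3 JL CS (add_mset (Frc w (Imp A B)) \<Gamma>) \<Delta>"
| RImp: "G3 JL CS (add_mset (Frc w A) \<Gamma>) (add_mset (Frc w B) \<Delta>) \<Longrightarrow>
    G3 JL CS \<Gamma> (add_mset (Frc w (Imp A B)) \<Delta>)"
| LJust: "G3 JL CS (add_mset (Frc v A) (add_mset (Frc w (Just t A)) (add_mset (Rel w v) \<Gamma>))) \<Delta> \<Longrightarrow>
    G3 JL CS (add_mset (Frc w (Just t A)) (add_mset (Rel w v) \<Gamma>)) \<Delta>"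
| RJust: "G3 JL CS (add_mset (Rel w v) (add_mset (Ev w t A) \<Gamma>)) (add_mset (Frc v A) \<Delta>) \<Longrightarrow>
    v \<notin> labels (add_mset (Ev w t A) \<Gamma>) \<Longrightarrow> v \<notin> labels (add_mset (Frc w (Just t A)) \<Delta>) \<Longrightarrow>
    G3 JL CS (add_mset (Ev w t A) \<Gamma>) (add_mset (Frc w (Just t A)) \<Delta>)"
| E: "G3 JL CS (add_mset (Ev w t A) (add_mset (Frc w (Just t A)) \<Gamma>)) \<Delta> \<Longrightarrow>
    G3 JL CS (add_mset (Frc w (Just t A)) \<Gamma>) \<Delta>"
| ElPlus: "G3 JL CS (add_mset (Ev w (Plus s t) A) (add_mset (Ev w t A) \<Gamma>)) \<Delta> \<Longrightarrow>
    G3 JL CS (add_mset (Ev w t A) \<Gamma>) \<Delta>"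
| ErPlus: "G3 JL CS (add_mset (Ev w (Plus t s) A) (add_mset (Ev w t A) \<Gamma>)) \<Delta> \<Longrightarrow>
    G3 JL CS (add_mset (Ev w t A) \<Gamma>) \<Delta>"
| EApp: "G3 JL CS (add_mset (Ev w (App s t) B)
      (add_mset (Ev w s (Imp A B)) (add_mset (Ev w t A) \<Gamma>))) \<Delta> \<Longrightarrow>
    G3 JL CS (add_mset (Ev w s (Imp A B)) (add_mset (Ev w t A) \<Gamma>)) \<Delta>"
| AN: "Just (Const c) F \<in> CS \<Longrightarrow> G3 JL CS (add_mset (Ev w (Const c) F) \<Gamma>) \<Delta> \<Longrightarrow>
    G3 JL CS \<Gamma> \<Delta>"
| Ref: "has_jT JL \<Longrightarrow> G3 JL CS (add_mset (Rel w w) \<Gamma>) \<Delta> \<Longrightarrow> G3 JL CS \<Gamma> \<Delta>"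
| Ser: "has_jD JL \<Longrightarrow> G3 JL CS (add_mset (Rel w v) \<Gamma>) \<Delta> \<Longrightarrow>
    v \<notin> labels \<Gamma> \<Longrightarrow> v \<notin> labels \<Delta> \<Longrightarrow> G3 JL CS \<Gamma> \<Delta>"
| EBang: "has_j4 JL \<Longrightarrow>
    G3 JL CS (add_mset (Ev w (Bang t) (Just t A)) (add_mset (Ev w t A) \<Gamma>)) \<Delta> \<Longrightarrow>
    G3 JL CS (add_mset (Ev w t A) \<Gamma>) \<Delta>"
| Mon: "has_j4 JL \<Longrightarrow>
    G3 JL CS (add_mset (Ev v t A) (add_mset (Ev w t A) (add_mset (Rel w v) \<Gamma>))) \<Delta> \<Longrightarrow>
    G3 JL CS (add_mset (Ev w t A) (add_mset (Rel w v) \<Gamma>)) \<Delta>"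
| Trans: "has_j4 JL \<Longrightarrow>
    G3 JL CS (add_mset (Rel w u) (add_mset (Rel w v) (add_mset (Rel v u) \<Gamma>))) \<Delta> \<Longrightarrow>
    G3 JL CS (add_mset (Rel w v) (add_mset (Rel v u) \<Gamma>)) \<Delta>"

lemma G3_in_language: "G3 JL CS \<Gamma> \<Delta> \<Longrightarrow> in_language JL \<Gamma> \<and> in_language JL \<Delta>"
  by (induction rule: G3.induct) (auto simp: in_language_def Fm_def Tm_def)

primrec validates :: "('p, 'x, 'c, 'w) model \<Rightarrow> (label \<Rightarrow> 'w) \<Rightarrow> ('p, 'x, 'c) lfm \<Rightarrow> bool" where
  "validates M i (Frc w A) \<longleftrightarrow> forces M (i w) A"
| "validates M i (Rel w v) \<longleftrightarrow> (i w, i v) \<in> acc M"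
| "validates M i (Ev w t A) \<longleftrightarrow> i w \<in> evid M t A"

definition countermodel :: "logic \<Rightarrow> ('p, 'x, 'c) fm set \<Rightarrow> ('p, 'x, 'c, 'w) model \<Rightarrow>
    ('p, 'x, 'c) lfm multiset \<Rightarrow> ('p, 'x, 'c) lfm multiset \<Rightarrow> bool" where
  "countermodel JL CS M \<Gamma> \<Delta> \<longleftrightarrow>
     fitting_model JL CS M \<and>
     (\<exists>i. (\<forall>l. i l \<in> worlds M) \<and>
          (\<forall>\<phi>\<in>#\<Gamma>. validates M i \<phi>) \<and> (\<forall>\<phi>\<in>#\<Delta>. \<not> validates M i \<phi>))"

end

theory Submission
  imports Defs
begin

text \<open>
  The countermodel is read off an open branch of a root-first proof search. Starting from an
  underivable sequent, a backward application of a rule always leaves at least one premise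
  underivable. Applying the rules fairly therefore produces an infinite branch of underivable
  sequents, and if \<open>G\<close> and \<open>D\<close> collect everything that ever occurs in their left and right hand
  sides, then \<open>G\<close> is made true and \<open>D\<close> is made false by the model whose worlds are the labels
  (\<open>saturated_truth\<close>).

  Two obstacles shape the details. The propositional rules and (R:) delete their principal formula,
  and one would like to reason with growing sets without proving contraction admissible. A branch is
  therefore described by the sets \<open>G\<close> and \<open>D\<close> of formulas that have occurred so far, together with
  its topmost sequent; each formula that has occurred is still in that sequent, or its rule has been
  applied to it (\<open>branch_top\<close>). Every rule is then a statement about enlarging \<open>G\<close> and \<open>D\<close>, and
  no structural rule is ever used.

  The other obstacle is that (El+) and (Er+) apply in as many ways as there are terms, possibly
  uncountably many, and (AN) applies at infinitely many labels. These rules, like all the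
  rules that only add evidence or relational atoms without a fresh label, are never scheduled.
  The model instead takes the closure of \<open>G\<close> under them (\<open>atom_closure\<close>) as evidence function and
  accessibility relation, which makes all conditions on Fitting models but seriality immediate. A single element of
  the closure has a finite justification, so it can be added to the branch at the moment when
  some rule or some initial sequent needs it (\<open>extends_to_closure\<close>). What remains to be scheduled at
  each stage is a finite set of duties: one for each formula present, and each label up to the
  stage number (\<open>stage_exists\<close>, \<open>open_branch_saturates\<close>).
\<close>

section \<open>Closure under the rules for evidence and relational atoms\<close>

inductive_set atom_closure :: "logic \<Rightarrow> ('p, 'x, 'c) fm set \<Rightarrow> ('p, 'x, 'c) lfm set \<Rightarrow>
    ('p, 'x, 'c) lfm set"
  for JL CS X where
  base: "\<phi> \<in> X \<Longrightarrow> \<phi> \<in> atom_closure JL CS X"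
| evid: "Frc w (Just t A) \<in> atom_closure JL CS X \<Longrightarrow> Ev w t A \<in> atom_closure JL CS X"
| plus_left: "Ev w t A \<in> atom_closure JL CS X \<Longrightarrow> s \<in> Tm JL \<Longrightarrow>
    Ev w (Plus s t) A \<in> atom_closure JL CS X"
| plus_right: "Ev w t A \<in> atom_closure JL CS X \<Longrightarrow> s \<in> Tm JL \<Longrightarrow>
    Ev w (Plus t s) A \<in> atom_closure JL CS X"
| app: "Ev w s (Imp A B) \<in> atom_closure JL CS X \<Longrightarrow> Ev w t A \<in> atom_closure JL CS X \<Longrightarrow>
    Ev w (App s t) B \<in> atom_closure JL CS X"
| const: "Just (Const c) F \<in> CS \<Longrightarrow> Ev w (Const c) F \<in> atom_closure JL CS X"
| reflexive: "has_jT JL \<Longrightarrow> Rel w w \<in> atom_closure JL CS X"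
| bang: "has_j4 JL \<Longrightarrow> Ev w t A \<in> atom_closure JL CS X \<Longrightarrow>
    Ev w (Bang t) (Just t A) \<in> atom_closure JL CS X"
| mon: "has_j4 JL \<Longrightarrow> Ev w t A \<in> atom_closure JL CS X \<Longrightarrow> Rel w v \<in> atom_closure JL CS X \<Longrightarrow>
    Ev v t A \<in> atom_closure JL CS X"
| transitive: "has_j4 JL \<Longrightarrow> Rel w v \<in> atom_closure JL CS X \<Longrightarrow> Rel v u \<in> atom_closure JL CS X \<Longrightarrow>
    Rel w u \<in> atom_closure JL CS X"

lemma atom_closure_mono:
  assumes "\<phi> \<in> atom_closure JL CS X" and "X \<subseteq> Y"
  shows "\<phi> \<in> atom_closure JL CS Y"
  using assms by (induction rule: atom_closure.induct) (auto intro: atom_closure.intros)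

text \<open>This carries facts about the limit of a branch back to one of its finite stages; each
  closure rule has at most two premises, so the maximum of two indices suffices.\<close>

lemma atom_closure_UN_chain:
  fixes G :: "nat \<Rightarrow> ('p, 'x, 'c) lfm set"
  assumes "\<phi> \<in> atom_closure JL CS (\<Union>n. G n)" and mono: "\<And>m n. m \<le> n \<Longrightarrow> G m \<subseteq> G n"
  shows "\<exists>n. \<phi> \<in> atom_closure JL CS (G n)"
proof -
  have up: "\<phi> \<in> atom_closure JL CS (G (max m n)) \<and> \<psi> \<in> atom_closure JL CS (G (max m n))"
    if "\<phi> \<in> atom_closure JL CS (G m)" "\<psi> \<in> atom_closure JL CS (G n)" for \<phi> \<psi> m n
    using that atom_closure_mono mono by (metis max.cobounded1 max.cobounded2)
  from assms(1) show ?thesis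
  proof (induction rule: atom_closure.induct)
    case (app w s A B t)
    then show ?case using up by (meson atom_closure.app)
  next
    case (mon w t A v)
    then show ?case using up by (meson atom_closure.mon)
  next
    case (transitive w v u)
    then show ?case using up by (meson atom_closure.transitive)
  qed (auto intro: atom_closure.intros)
qed

section \<open>Open branches\<close>

text \<open>What a premise of the rule for \<open>\<phi>\<close> adds, if that rule deletes \<open>\<phi>\<close>. A formula that no rule
  deletes on its side counts as never reduced, and so must persist in the sequent.\<close>

fun reducedL :: "('p, 'x, 'c) lfm set \<Rightarrow> ('p, 'x, 'c) lfm set \<Rightarrow> ('p, 'x, 'c) lfm \<Rightarrow> bool" where
  "reducedL G D (Frc w (Neg A)) \<longleftrightarrow> Frc w A \<in> D"
| "reducedL G D (Frc w (And A B)) \<longleftrightarrow> Frc w A \<in> G \<and> Frc w B \<in> G"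
| "reducedL G D (Frc w (Or A B)) \<longleftrightarrow> Frc w A \<in> G \<or> Frc w B \<in> G"
| "reducedL G D (Frc w (Imp A B)) \<longleftrightarrow> Frc w A \<in> D \<or> Frc w B \<in> G"
| "reducedL G D _ \<longleftrightarrow> False"

fun reducedR :: "('p, 'x, 'c) lfm set \<Rightarrow> ('p, 'x, 'c) lfm set \<Rightarrow> ('p, 'x, 'c) lfm \<Rightarrow> bool" where
  "reducedR G D (Frc w (Neg A)) \<longleftrightarrow> Frc w A \<in> G"
| "reducedR G D (Frc w (And A B)) \<longleftrightarrow> Frc w A \<in> D \<or> Frc w B \<in> D"
| "reducedR G D (Frc w (Or A B)) \<longleftrightarrow> Frc w A \<in> D \<and> Frc w B \<in> D"
| "reducedR G D (Frc w (Imp A B)) \<longleftrightarrow> Frc w A \<in> G \<and> Frc w B \<in> D"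
| "reducedR G D (Frc w (Just t A)) \<longleftrightarrow> (\<exists>v. Rel w v \<in> G \<and> Frc v A \<in> D)"
| "reducedR G D _ \<longleftrightarrow> False"

lemma reducedL_mono: "reducedL G D \<phi> \<Longrightarrow> G \<subseteq> G' \<Longrightarrow> D \<subseteq> D' \<Longrightarrow> reducedL G' D' \<phi>"
  by (induction G D \<phi> rule: reducedL.induct) auto

lemma reducedR_mono: "reducedR G D \<phi> \<Longrightarrow> G \<subseteq> G' \<Longrightarrow> D \<subseteq> D' \<Longrightarrow> reducedR G' D' \<phi>"
  by (induction G D \<phi> rule: reducedR.induct) auto

text \<open>\<open>\<Gamma> \<Rightarrow> \<Delta>\<close> is the topmost sequent so far of a branch of the search tree on which the formulas of
  \<open>G\<close> and \<open>D\<close> have occurred. Being reduced is monotone in \<open>G\<close> and \<open>D\<close>, so a formula that was once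
  decomposed stays accounted for when the branch grows. The sets are finite in order
  that only finitely many duties are due at any time.\<close>

definition branch_top :: "logic \<Rightarrow> ('p, 'x, 'c) fm set \<Rightarrow>
    ('p, 'x, 'c) lfm multiset \<Rightarrow> ('p, 'x, 'c) lfm multiset \<Rightarrow>
    ('p, 'x, 'c) lfm set \<Rightarrow> ('p, 'x, 'c) lfm set \<Rightarrow> bool" where
  "branch_top JL CS \<Gamma> \<Delta> G D \<longleftrightarrow>
     \<not> G3 JL CS \<Gamma> \<Delta> \<and> in_language JL \<Gamma> \<and> in_language JL \<Delta> \<and> finite G \<and> finite D \<and>
     set_mset \<Gamma> \<subseteq> G \<and> set_mset \<Delta> \<subseteq> D \<and>
     (\<forall>\<phi>\<in>G. \<phi> \<in># \<Gamma> \<or> reducedL G D \<phi>) \<and> (\<forall>\<phi>\<in>D. \<phi> \<in># \<Delta> \<or> reducedR G D \<phi>)"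

definition open_branch :: "logic \<Rightarrow> ('p, 'x, 'c) fm set \<Rightarrow>
    ('p, 'x, 'c) lfm set \<Rightarrow> ('p, 'x, 'c) lfm set \<Rightarrow> bool" where
  "open_branch JL CS G D \<longleftrightarrow> (\<exists>\<Gamma> \<Delta>. branch_top JL CS \<Gamma> \<Delta> G D)"

lemma branch_top_left: "branch_top JL CS \<Gamma> \<Delta> G D \<Longrightarrow> \<phi> \<in> G \<Longrightarrow> \<phi> \<in># \<Gamma> \<or> reducedL G D \<phi>"
  and branch_top_right: "branch_top JL CS \<Gamma> \<Delta> G D \<Longrightarrow> \<phi> \<in> D \<Longrightarrow> \<phi> \<in># \<Delta> \<or> reducedR G D \<phi>"
  and branch_top_not_derivable: "branch_top JL CS \<Gamma> \<Delta> G D \<Longrightarrow> \<not> G3 JL CS \<Gamma> \<Delta>"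
  unfolding branch_top_def by simp_all

lemma open_branch_initial:
  assumes "\<not> G3 JL CS \<Gamma> \<Delta>" "in_language JL \<Gamma>" "in_language JL \<Delta>"
  shows "open_branch JL CS (set_mset \<Gamma>) (set_mset \<Delta>)"
  using assms unfolding open_branch_def branch_top_def by blast

text \<open>The common form of all backward rule applications: the new topmost sequent may drop a formula
  only if it records the components of that formula.\<close>

lemma branch_top_extend:
  assumes top: "branch_top JL CS \<Gamma> \<Delta> G D"
    and "\<not> G3 JL CS \<Gamma>' \<Delta>'" "in_language JL \<Gamma>'" "in_language JL \<Delta>'"
    and eqs: "G' = G \<union> set_mset \<Gamma>'" "D' = D \<union> set_mset \<Delta>'"
    and left: "\<And>\<phi>. \<phi> \<in># \<Gamma> \<Longrightarrow> \<phi> \<in># \<Gamma>' \<or> reducedL G' D' \<phi>"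
    and right: "\<And>\<phi>. \<phi> \<in># \<Delta> \<Longrightarrow> \<phi> \<in># \<Delta>' \<or> reducedR G' D' \<phi>"
  shows "open_branch JL CS G' D'"
proof -
  have sub: "G \<subseteq> G'" "D \<subseteq> D'" using eqs by auto
  have "\<phi> \<in># \<Gamma>' \<or> reducedL G' D' \<phi>" if "\<phi> \<in> G'" for \<phi>
    using that top left reducedL_mono[OF _ sub] eqs unfolding branch_top_def by blast
  moreover have "\<phi> \<in># \<Delta>' \<or> reducedR G' D' \<phi>" if "\<phi> \<in> D'" for \<phi>
    using that top right reducedR_mono[OF _ sub] eqs unfolding branch_top_def by blast
  ultimately have "branch_top JL CS \<Gamma>' \<Delta>' G' D'"
    using assms(2-4) top eqs unfolding branch_top_def by auto
  then show ?thesis unfolding open_branch_def by blast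
qed

definition extends_to :: "logic \<Rightarrow> ('p, 'x, 'c) fm set \<Rightarrow> ('p, 'x, 'c) lfm set \<Rightarrow>
    ('p, 'x, 'c) lfm set \<Rightarrow> (('p, 'x, 'c) lfm set \<Rightarrow> ('p, 'x, 'c) lfm set \<Rightarrow> bool) \<Rightarrow> bool" where
  "extends_to JL CS G D P \<longleftrightarrow> (\<exists>G' D'. G \<subseteq> G' \<and> D \<subseteq> D' \<and> open_branch JL CS G' D' \<and> P G' D')"

lemma extends_to_refl: "open_branch JL CS G D \<Longrightarrow> P G D \<Longrightarrow> extends_to JL CS G D P"
  unfolding extends_to_def by blast

lemma extends_to_if_top:
  assumes "branch_top JL CS \<Gamma> \<Delta> G D"
    and "\<not> G3 JL CS \<Gamma>' \<Delta>'" "in_language JL \<Gamma>'" "in_language JL \<Delta>'"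
    and "\<And>\<phi>. \<phi> \<in># \<Gamma> \<Longrightarrow> \<phi> \<in># \<Gamma>' \<or> reducedL (G \<union> set_mset \<Gamma>') (D \<union> set_mset \<Delta>') \<phi>"
    and "\<And>\<phi>. \<phi> \<in># \<Delta> \<Longrightarrow> \<phi> \<in># \<Delta>' \<or> reducedR (G \<union> set_mset \<Gamma>') (D \<union> set_mset \<Delta>') \<phi>"
    and "P (G \<union> set_mset \<Gamma>') (D \<union> set_mset \<Delta>')"
  shows "extends_to JL CS G D P"
  using branch_top_extend[OF assms(1-4) refl refl assms(5,6)] assms(7)
  unfolding extends_to_def by blast

text \<open>Rule (AN) must not leave the language of \<open>JL\<close>: a sequent outside the language is underivable
  for a trivial reason, and would make a branch open without giving a model.\<close>

lemma constant_spec_in_Fm: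
  assumes "constant_spec JL CS" "Just (Const c) F \<in> CS"
  shows "F \<in> Fm JL"
proof (cases "has_j4 JL")
  case True
  then show ?thesis using assms by (auto simp: constant_spec_def axiom_instances_def)
next
  case False
  then obtain cs A where cs: "Just (Const c) F = const_prefix cs A" "cs \<noteq> []"
      "A \<in> axiom_instances JL"
    using assms by (auto simp: constant_spec_def)
  have "fm_in JL (const_prefix ds A)" for ds
    using cs(3) by (induction ds) (auto simp: const_prefix_def axiom_instances_def Fm_def)
  then show ?thesis
    using cs by (cases cs) (auto simp: const_prefix_def Fm_def)
qed

lemma finite_labels: "finite (labels \<Gamma>)"
proof -
  have "finite (lfm_labels \<phi>)" for \<phi> :: "('p, 'x, 'c) lfm" by (cases \<phi>) auto
  then show ?thesis by (auto simp: labels_def)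
qed

lemma fresh_label: "\<exists>v. v \<notin> labels \<Gamma> \<and> v \<notin> labels \<Delta>"
  using ex_new_if_finite[OF infinite_UNIV_nat finite_UnI[OF finite_labels finite_labels]] by blast

text \<open>The rules that only add a formula on the left. Their principal formulas are never decomposed
  on the left, hence they still belong to the topmost sequent.\<close>

lemma open_branch_insert:
  assumes "open_branch JL CS G D" and "lfm_in JL \<phi>"
    and "\<And>\<Gamma> \<Delta>. (\<And>\<psi>. \<psi> \<in> G \<Longrightarrow> (\<And>G D. \<not> reducedL G D \<psi>) \<Longrightarrow> \<psi> \<in># \<Gamma>) \<Longrightarrow>
       G3 JL CS (add_mset \<phi> \<Gamma>) \<Delta> \<Longrightarrow> G3 JL CS \<Gamma> \<Delta>"
  shows "open_branch JL CS (insert \<phi> G) D"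
proof -
  obtain \<Gamma> \<Delta> where top: "branch_top JL CS \<Gamma> \<Delta> G D"
    using assms(1) by (auto simp: open_branch_def)
  have "\<not> G3 JL CS (add_mset \<phi> \<Gamma>) \<Delta>"
    using assms(3)[of \<Gamma> \<Delta>] top unfolding branch_top_def by blast
  then show ?thesis
    using assms(2) top
    by (intro branch_top_extend[OF top]) (auto simp: branch_top_def in_language_def)
qed

lemma open_branch_in_language:
  assumes "open_branch JL CS G D" "\<phi> \<in> G" "\<And>G D. \<not> reducedL G D \<phi>"
  shows "lfm_in JL \<phi>"
  using assms unfolding open_branch_def branch_top_def in_language_def by blast

text \<open>The two principal evidence atoms of (E\<open>\<cdot>\<close>) are different, so both can be split off the
  multiset even if each of them occurs only once.\<close>

lemma Imp_neq_antecedent: "Imp A B \<noteq> A"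
proof
  assume "Imp A B = A"
  then have "size (Imp A B) = size A" by simp
  then show False by simp
qed

lemma two_members:
  assumes "a \<in># M" "b \<in># M" "a \<noteq> b"
  obtains N where "M = add_mset a (add_mset b N)"
  using assms by (metis insert_DiffM insert_noteq_member)

lemma open_branch_insert_from_one:
  assumes "open_branch JL CS G D" and "lfm_in JL \<phi>"
    and "\<psi> \<in> G" and "\<And>G D. \<not> reducedL G D \<psi>"
    and rule: "\<And>\<Gamma> \<Delta>. G3 JL CS (add_mset \<phi> (add_mset \<psi> \<Gamma>)) \<Delta> \<Longrightarrow> G3 JL CS (add_mset \<psi> \<Gamma>) \<Delta>"
  shows "open_branch JL CS (insert \<phi> G) D"
proof (rule open_branch_insert[OF assms(1,2)])
  fix \<Gamma> \<Delta>
  assume "\<And>\<psi>. \<psi> \<in> G \<Longrightarrow> (\<And>G D. \<not> reducedL G D \<psi>) \<Longrightarrow> \<psi> \<in># \<Gamma>"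
    and d: "G3 JL CS (add_mset \<phi> \<Gamma>) \<Delta>"
  then have "\<psi> \<in># \<Gamma>" using assms(3,4) by blast
  then show "G3 JL CS \<Gamma> \<Delta>" using d rule by (metis insert_DiffM)
qed

lemma open_branch_insert_from_two:
  assumes "open_branch JL CS G D" and "lfm_in JL \<phi>"
    and "\<psi> \<in> G" and "\<And>G D. \<not> reducedL G D \<psi>"
    and "\<chi> \<in> G" and "\<And>G D. \<not> reducedL G D \<chi>" and "\<psi> \<noteq> \<chi>"
    and rule: "\<And>\<Gamma> \<Delta>. G3 JL CS (add_mset \<phi> (add_mset \<psi> (add_mset \<chi> \<Gamma>))) \<Delta> \<Longrightarrow>
      G3 JL CS (add_mset \<psi> (add_mset \<chi> \<Gamma>)) \<Delta>"
  shows "open_branch JL CS (insert \<phi> G) D"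
proof (rule open_branch_insert[OF assms(1,2)])
  fix \<Gamma> \<Delta>
  assume "\<And>\<psi>. \<psi> \<in> G \<Longrightarrow> (\<And>G D. \<not> reducedL G D \<psi>) \<Longrightarrow> \<psi> \<in># \<Gamma>"
    and d: "G3 JL CS (add_mset \<phi> \<Gamma>) \<Delta>"
  then have "\<psi> \<in># \<Gamma>" "\<chi> \<in># \<Gamma>" using assms(3-6) by blast+
  then obtain N where "\<Gamma> = add_mset \<psi> (add_mset \<chi> N)"
    using assms(7) by (rule two_members)
  then show "G3 JL CS \<Gamma> \<Delta>" using d rule by simp
qed

text \<open>The rules that generate the closure are rules of the calculus, hence an open branch can be
  continued until it contains any prescribed element of the closure. For a rule with two premises
  the second is obtained on the continuation that already contains the first; for this reason \<open>G\<close> is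
  an arbitrary superset of \<open>X\<close>.\<close>

lemma extends_to_closure:
  assumes "\<phi> \<in> atom_closure JL CS X" and CS: "constant_spec JL CS"
    and "X \<subseteq> G" and "open_branch JL CS G D"
  shows "\<exists>G'. G \<subseteq> G' \<and> \<phi> \<in> G' \<and> open_branch JL CS G' D"
  using assms(1,3,4)
proof (induction arbitrary: G rule: atom_closure.induct)
  case (base \<phi>)
  then show ?case by blast
next
  case (evid w t A)
  then obtain G' where G': "G \<subseteq> G'" "Frc w (Just t A) \<in> G'" "open_branch JL CS G' D"
    by blast
  have "lfm_in JL (Frc w (Just t A))" by (rule open_branch_in_language[OF G'(3,2)]) simp
  then have "open_branch JL CS (insert (Ev w t A) G') D"
    by (intro open_branch_insert_from_one[OF G'(3) _ G'(2) _ G3.E])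
      (simp_all add: Fm_def Tm_def)
  then show ?case using G' by blast
next
  case (plus_left w t A s)
  then obtain G' where G': "G \<subseteq> G'" "Ev w t A \<in> G'" "open_branch JL CS G' D"
    by blast
  have "lfm_in JL (Ev w t A)" by (rule open_branch_in_language[OF G'(3,2)]) simp
  then have "open_branch JL CS (insert (Ev w (Plus s t) A) G') D"
    using plus_left.hyps
    by (intro open_branch_insert_from_one[OF G'(3) _ G'(2) _ G3.ElPlus])
      (simp_all add: Fm_def Tm_def)
  then show ?case using G' by blast
next
  case (plus_right w t A s)
  then obtain G' where G': "G \<subseteq> G'" "Ev w t A \<in> G'" "open_branch JL CS G' D"
    by blast
  have "lfm_in JL (Ev w t A)" by (rule open_branch_in_language[OF G'(3,2)]) simp
  then have "open_branch JL CS (insert (Ev w (Plus t s) A) G') D"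
    using plus_right.hyps
    by (intro open_branch_insert_from_one[OF G'(3) _ G'(2) _ G3.ErPlus])
      (simp_all add: Fm_def Tm_def)
  then show ?case using G' by blast
next
  case (app w s A B t)
  obtain G1 where G1: "G \<subseteq> G1" "Ev w s (Imp A B) \<in> G1" "open_branch JL CS G1 D"
    using app.IH(1)[OF app.prems] by blast
  obtain G' where G': "G1 \<subseteq> G'" "Ev w t A \<in> G'" "open_branch JL CS G' D"
    using app.IH(2)[of G1] app.prems G1 by blast
  have G1': "Ev w s (Imp A B) \<in> G'" and sub: "G \<subseteq> G'" using G1(1,2) G'(1) by blast+
  have "lfm_in JL (Ev w s (Imp A B))" by (rule open_branch_in_language[OF G'(3) G1']) simp
  moreover have "lfm_in JL (Ev w t A)" by (rule open_branch_in_language[OF G'(3,2)]) simp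
  ultimately have "open_branch JL CS (insert (Ev w (App s t) B) G') D"
    using Imp_neq_antecedent[of A B]
    by (intro open_branch_insert_from_two[OF G'(3) _ G1' _ G'(2) _ _ G3.EApp])
      (simp_all add: Fm_def Tm_def)
  then show ?case using sub by blast
next
  case (const c F w)
  have "open_branch JL CS (insert (Ev w (Const c) F) G) D"
    using constant_spec_in_Fm[OF CS const.hyps] G3.AN[OF const.hyps]
    by (intro open_branch_insert[OF const.prems(2)]) (auto simp: Tm_def)
  then show ?case by blast
next
  case (reflexive w)
  have "open_branch JL CS (insert (Rel w w) G) D"
    using G3.Ref[OF reflexive.hyps]
    by (intro open_branch_insert[OF reflexive.prems(2)]) auto
  then show ?case by blast
next
  case (bang w t A)
  then obtain G' where G': "G \<subseteq> G'" "Ev w t A \<in> G'" "open_branch JL CS G' D"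
    by blast
  have "lfm_in JL (Ev w t A)" by (rule open_branch_in_language[OF G'(3,2)]) simp
  then have "open_branch JL CS (insert (Ev w (Bang t) (Just t A)) G') D"
    using bang.hyps(1)
    by (intro open_branch_insert_from_one[OF G'(3) _ G'(2) _ G3.EBang[OF bang.hyps(1)]])
      (simp_all add: Fm_def Tm_def)
  then show ?case using G' by blast
next
  case (mon w t A v)
  obtain G1 where G1: "G \<subseteq> G1" "Ev w t A \<in> G1" "open_branch JL CS G1 D"
    using mon.IH(1)[OF mon.prems] by blast
  obtain G' where G': "G1 \<subseteq> G'" "Rel w v \<in> G'" "open_branch JL CS G' D"
    using mon.IH(2)[of G1] mon.prems G1 by blast
  have G1': "Ev w t A \<in> G'" and sub: "G \<subseteq> G'" using G1(1,2) G'(1) by blast+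
  have "lfm_in JL (Ev w t A)" by (rule open_branch_in_language[OF G'(3) G1']) simp
  then have "open_branch JL CS (insert (Ev v t A) G') D"
    by (intro open_branch_insert_from_two[OF G'(3) _ G1' _ G'(2) _ _ G3.Mon[OF mon.hyps(1)]])
      (simp_all add: Fm_def Tm_def)
  then show ?case using sub by blast
next
  case (transitive w v u)
  obtain G1 where G1: "G \<subseteq> G1" "Rel w v \<in> G1" "open_branch JL CS G1 D"
    using transitive.IH(1)[OF transitive.prems] by blast
  obtain G' where G': "G1 \<subseteq> G'" "Rel v u \<in> G'" "open_branch JL CS G' D"
    using transitive.IH(2)[of G1] transitive.prems G1 by blast
  have G1': "Rel w v \<in> G'" and sub: "G \<subseteq> G'" using G1(1,2) G'(1) by blast+
  \<comment> \<open>(Trans) needs two occurrences if \<open>w = v = u\<close>, but then there is nothing to add.\<close>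
  show ?case
  proof (cases "Rel w u \<in> G'")
    case True
    then show ?thesis using sub G'(2,3) by blast
  next
    case False
    have "open_branch JL CS (insert (Rel w u) G') D"
      using False G1'
      by (intro open_branch_insert_from_two[OF G'(3) _ G1' _ G'(2) _ _ G3.Trans[OF transitive.hyps(1)]])
        auto
    then show ?thesis using sub G'(2,3) by blast
  qed
qed

section \<open>Open branches do not clash\<close>

lemma open_branch_no_Bot:
  assumes "open_branch JL CS G D"
  shows "Frc w Bot \<notin> G"
proof
  assume "Frc w Bot \<in> G"
  obtain \<Gamma> \<Delta> where top: "branch_top JL CS \<Gamma> \<Delta> G D"
    using assms by (auto simp: open_branch_def)
  have "Frc w Bot \<in># \<Gamma>"
    using branch_top_left[OF top \<open>Frc w Bot \<in> G\<close>] by simp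
  then obtain \<Gamma>0 where \<Gamma>: "\<Gamma> = add_mset (Frc w Bot) \<Gamma>0" by (meson multi_member_split)
  have "in_language JL \<Gamma>0" "in_language JL \<Delta>"
    using top \<Gamma> by (auto simp: branch_top_def in_language_def)
  then have "G3 JL CS \<Gamma> \<Delta>" unfolding \<Gamma> by (rule InitBot)
  then show False using branch_top_not_derivable[OF top] by simp
qed

fun atomic :: "('p, 'x, 'c) lfm \<Rightarrow> bool" where
  "atomic (Frc w (Atom p)) \<longleftrightarrow> True"
| "atomic (Rel w v) \<longleftrightarrow> True"
| "atomic (Ev w t A) \<longleftrightarrow> True"
| "atomic _ \<longleftrightarrow> False"

lemma atomic_not_reduced: "atomic \<phi> \<Longrightarrow> \<not> reducedL G D \<phi> \<and> \<not> reducedR G D \<phi>"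
  by (cases \<phi> rule: atomic.cases) auto

lemma G3_initial:
  assumes "atomic \<phi>" "lfm_in JL \<phi>" "in_language JL \<Gamma>" "in_language JL \<Delta>"
  shows "G3 JL CS (add_mset \<phi> \<Gamma>) (add_mset \<phi> \<Delta>)"
  using assms by (cases \<phi> rule: atomic.cases) (simp_all add: InitP InitR InitE)

text \<open>An atom of the closure can be made a member of the topmost sequent, and so can any atom of \<open>D\<close>;
  if these were the same atom, then that sequent would be initial.\<close>

lemma open_branch_no_clash:
  assumes CS: "constant_spec JL CS" and op: "open_branch JL CS G D"
    and cl: "\<phi> \<in> atom_closure JL CS G" and at: "atomic \<phi>"
  shows "\<phi> \<notin> D"
proof
  assume "\<phi> \<in> D"
  obtain G' where "\<phi> \<in> G'" "open_branch JL CS G' D"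
    using extends_to_closure[OF cl CS subset_refl op] by blast
  then obtain \<Gamma> \<Delta> where top: "branch_top JL CS \<Gamma> \<Delta> G' D"
    by (auto simp: open_branch_def)
  have "\<phi> \<in># \<Gamma>" "\<phi> \<in># \<Delta>"
    using branch_top_left[OF top \<open>\<phi> \<in> G'\<close>] branch_top_right[OF top \<open>\<phi> \<in> D\<close>]
      atomic_not_reduced[OF at] by blast+
  then obtain \<Gamma>0 \<Delta>0 where eqs: "\<Gamma> = add_mset \<phi> \<Gamma>0" "\<Delta> = add_mset \<phi> \<Delta>0"
    by (meson multi_member_split)
  have "lfm_in JL \<phi>" "in_language JL \<Gamma>0" "in_language JL \<Delta>0"
    using top eqs by (auto simp: branch_top_def in_language_def)
  then have "G3 JL CS \<Gamma> \<Delta>" unfolding eqs using at by (intro G3_initial)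
  then show False using branch_top_not_derivable[OF top] by simp
qed

section \<open>Extending open branches\<close>

text \<open>What fairness demands. The set \<open>K\<close> is the closure against which the rules (L:) and (R:) are
  checked: (L:) must be used on each label accessible according to \<open>K\<close>, and (R:) must be used only if
  \<open>K\<close> contains the evidence atom that the rule requires. Without that evidence a formula \<open>t:A\<close> on the
  right is false in the model already, and it may stay in the sequent forever.\<close>

fun dutyL :: "('p, 'x, 'c) lfm set \<Rightarrow> label \<Rightarrow> ('p, 'x, 'c) lfm \<Rightarrow>
    ('p, 'x, 'c) lfm set \<Rightarrow> ('p, 'x, 'c) lfm set \<Rightarrow> bool" where
  "dutyL K v (Frc w (Just t A)) G D \<longleftrightarrow> (Rel w v \<in> K \<longrightarrow> Frc v A \<in> G)"
| "dutyL K v (Frc w (Atom p)) G D \<longleftrightarrow> True"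
| "dutyL K v (Frc w Bot) G D \<longleftrightarrow> True"
| "dutyL K v (Rel w u) G D \<longleftrightarrow> True"
| "dutyL K v (Ev w t A) G D \<longleftrightarrow> True"
| "dutyL K v \<phi> G D \<longleftrightarrow> reducedL G D \<phi>"

fun dutyR :: "('p, 'x, 'c) lfm set \<Rightarrow> ('p, 'x, 'c) lfm \<Rightarrow>
    ('p, 'x, 'c) lfm set \<Rightarrow> ('p, 'x, 'c) lfm set \<Rightarrow> bool" where
  "dutyR K (Frc w (Just t A)) G D \<longleftrightarrow> (Ev w t A \<in> K \<longrightarrow> reducedR G D (Frc w (Just t A)))"
| "dutyR K (Frc w (Atom p)) G D \<longleftrightarrow> True"
| "dutyR K (Frc w Bot) G D \<longleftrightarrow> True"
| "dutyR K (Rel w u) G D \<longleftrightarrow> True"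
| "dutyR K (Ev w t A) G D \<longleftrightarrow> True"
| "dutyR K \<phi> G D \<longleftrightarrow> reducedR G D \<phi>"

lemma dutyL_mono: "dutyL K v \<phi> G D \<Longrightarrow> G \<subseteq> G' \<Longrightarrow> D \<subseteq> D' \<Longrightarrow> dutyL K v \<phi> G' D'"
  by (induction K v \<phi> G D rule: dutyL.induct) auto

lemma dutyR_mono: "dutyR K \<phi> G D \<Longrightarrow> G \<subseteq> G' \<Longrightarrow> D \<subseteq> D' \<Longrightarrow> dutyR K \<phi> G' D'"
  by (induction K \<phi> G D rule: dutyR.induct) auto

lemma dutyL_transfer:
  "dutyL K v \<phi> G D \<Longrightarrow> (\<And>w t A. \<phi> = Frc w (Just t A) \<Longrightarrow> Rel w v \<in> K' \<Longrightarrow> Rel w v \<in> K) \<Longrightarrow>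
   dutyL K' v \<phi> G D"
  by (induction K v \<phi> G D rule: dutyL.induct) auto

lemma dutyR_transfer:
  "dutyR K \<phi> G D \<Longrightarrow> (\<And>w t A. \<phi> = Frc w (Just t A) \<Longrightarrow> Ev w t A \<in> K' \<Longrightarrow> Ev w t A \<in> K) \<Longrightarrow>
   dutyR K' \<phi> G D"
  by (induction K \<phi> G D rule: dutyR.induct) auto

text \<open>Each propositional rule applied backwards to an underivable sequent leaves one of its premises
  underivable; that premise continues the branch.\<close>

lemma extends_to_reducedL:
  assumes op: "open_branch JL CS G D" and "Frc w C \<in> G"
    and compound: "(\<exists>A. C = Neg A) \<or> (\<exists>A B. C = And A B \<or> C = Or A B \<or> C = Imp A B)"
  shows "extends_to JL CS G D (\<lambda>G D. reducedL G D (Frc w C))"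
proof -
  obtain \<Gamma> \<Delta> where top: "branch_top JL CS \<Gamma> \<Delta> G D"
    using op by (auto simp: open_branch_def)
  show ?thesis
  proof (cases "reducedL G D (Frc w C)")
    case True
    then show ?thesis using op by (intro extends_to_refl)
  next
    case False
    then have "Frc w C \<in># \<Gamma>" using branch_top_left[OF top assms(2)] by blast
    then obtain \<Gamma>0 where \<Gamma>: "\<Gamma> = add_mset (Frc w C) \<Gamma>0" by (auto dest: multi_member_split)
    have nd: "\<not> G3 JL CS (add_mset (Frc w C) \<Gamma>0) \<Delta>"
      and lang: "fm_in JL C" "in_language JL \<Gamma>0" "in_language JL \<Delta>"
      using top \<Gamma> by (auto simp: branch_top_def in_language_def Fm_def)
    note ext = extends_to_if_top[OF top]
    from compound show ?thesis
    proof (elim disjE exE)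
      fix A assume C: "C = Neg A"
      then have n: "\<not> G3 JL CS \<Gamma>0 (add_mset (Frc w A) \<Delta>)" using nd G3.LNeg by blast
      show ?thesis
        using lang C \<Gamma> by (intro ext[OF n]) (auto simp: in_language_def Fm_def)
    next
      fix A B assume C: "C = And A B"
      then have n: "\<not> G3 JL CS (add_mset (Frc w A) (add_mset (Frc w B) \<Gamma>0)) \<Delta>"
        using nd G3.LAnd by blast
      show ?thesis
        using lang C \<Gamma> by (intro ext[OF n]) (auto simp: in_language_def Fm_def)
    next
      fix A B assume C: "C = Or A B"
      then have "\<not> G3 JL CS (add_mset (Frc w A) \<Gamma>0) \<Delta> \<or> \<not> G3 JL CS (add_mset (Frc w B) \<Gamma>0) \<Delta>"
        using nd G3.LOr by blast
      then show ?thesis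
      proof
        assume n: "\<not> G3 JL CS (add_mset (Frc w A) \<Gamma>0) \<Delta>"
        show ?thesis using lang C \<Gamma> by (intro ext[OF n]) (auto simp: in_language_def Fm_def)
      next
        assume n: "\<not> G3 JL CS (add_mset (Frc w B) \<Gamma>0) \<Delta>"
        show ?thesis using lang C \<Gamma> by (intro ext[OF n]) (auto simp: in_language_def Fm_def)
      qed
    next
      fix A B assume C: "C = Imp A B"
      then have "\<not> G3 JL CS \<Gamma>0 (add_mset (Frc w A) \<Delta>) \<or> \<not> G3 JL CS (add_mset (Frc w B) \<Gamma>0) \<Delta>"
        using nd G3.LImp by blast
      then show ?thesis
      proof
        assume n: "\<not> G3 JL CS \<Gamma>0 (add_mset (Frc w A) \<Delta>)"
        show ?thesis using lang C \<Gamma> by (intro ext[OF n]) (auto simp: in_language_def Fm_def)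
      next
        assume n: "\<not> G3 JL CS (add_mset (Frc w B) \<Gamma>0) \<Delta>"
        show ?thesis using lang C \<Gamma> by (intro ext[OF n]) (auto simp: in_language_def Fm_def)
      qed
    qed
  qed
qed

text \<open>The premise on \<open>t:A\<close> reflects that (R:) has the evidence atom as a second principal formula.
  That atom is still in the topmost sequent, because no rule removes it.\<close>

lemma extends_to_reducedR:
  assumes op: "open_branch JL CS G D" and "Frc w C \<in> D"
    and compound: "(\<exists>A. C = Neg A) \<or> (\<exists>A B. C = And A B \<or> C = Or A B \<or> C = Imp A B)
      \<or> (\<exists>t A. C = Just t A \<and> Ev w t A \<in> G)"
  shows "extends_to JL CS G D (\<lambda>G D. reducedR G D (Frc w C))"
proof -
  obtain \<Gamma> \<Delta> where top: "branch_top JL CS \<Gamma> \<Delta> G D"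
    using op by (auto simp: open_branch_def)
  show ?thesis
  proof (cases "reducedR G D (Frc w C)")
    case True
    then show ?thesis using op by (intro extends_to_refl)
  next
    case False
    then have "Frc w C \<in># \<Delta>" using branch_top_right[OF top assms(2)] by blast
    then obtain \<Delta>0 where \<Delta>: "\<Delta> = add_mset (Frc w C) \<Delta>0" by (auto dest: multi_member_split)
    have nd: "\<not> G3 JL CS \<Gamma> (add_mset (Frc w C) \<Delta>0)"
      and lang: "fm_in JL C" "in_language JL \<Gamma>" "in_language JL \<Delta>0"
      using top \<Delta> by (auto simp: branch_top_def in_language_def Fm_def)
    note ext = extends_to_if_top[OF top]
    from compound show ?thesis
    proof (elim disjE exE conjE)
      fix A assume C: "C = Neg A"
      then have n: "\<not> G3 JL CS (add_mset (Frc w A) \<Gamma>) \<Delta>0" using nd G3.RNeg by blast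
      show ?thesis
        using lang C \<Delta> by (intro ext[OF n]) (auto simp: in_language_def Fm_def)
    next
      fix A B assume C: "C = And A B"
      then have "\<not> G3 JL CS \<Gamma> (add_mset (Frc w A) \<Delta>0) \<or> \<not> G3 JL CS \<Gamma> (add_mset (Frc w B) \<Delta>0)"
        using nd G3.RAnd by blast
      then show ?thesis
      proof
        assume n: "\<not> G3 JL CS \<Gamma> (add_mset (Frc w A) \<Delta>0)"
        show ?thesis using lang C \<Delta> by (intro ext[OF n]) (auto simp: in_language_def Fm_def)
      next
        assume n: "\<not> G3 JL CS \<Gamma> (add_mset (Frc w B) \<Delta>0)"
        show ?thesis using lang C \<Delta> by (intro ext[OF n]) (auto simp: in_language_def Fm_def)
      qed
    next
      fix A B assume C: "C = Or A B"
      then have n: "\<not> G3 JL CS \<Gamma> (add_mset (Frc w A) (add_mset (Frc w B) \<Delta>0))"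
        using nd G3.ROr by blast
      show ?thesis
        using lang C \<Delta> by (intro ext[OF n]) (auto simp: in_language_def Fm_def)
    next
      fix A B assume C: "C = Imp A B"
      then have n: "\<not> G3 JL CS (add_mset (Frc w A) \<Gamma>) (add_mset (Frc w B) \<Delta>0)"
        using nd G3.RImp by blast
      show ?thesis
        using lang C \<Delta> by (intro ext[OF n]) (auto simp: in_language_def Fm_def)
    next
      fix t A assume C: "C = Just t A" and ev: "Ev w t A \<in> G"
      have "Ev w t A \<in># \<Gamma>" using branch_top_left[OF top ev] by simp
      then obtain \<Gamma>0 where \<Gamma>: "\<Gamma> = add_mset (Ev w t A) \<Gamma>0" by (auto dest: multi_member_split)
      obtain v where "v \<notin> labels \<Gamma>" "v \<notin> labels \<Delta>" using fresh_label by blast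
      then have n: "\<not> G3 JL CS (add_mset (Rel w v) \<Gamma>) (add_mset (Frc v A) \<Delta>0)"
        using nd G3.RJust[of JL CS w v t A \<Gamma>0 \<Delta>0] C \<Gamma> \<Delta> by blast
      show ?thesis
        using lang C \<Delta> by (intro ext[OF n]) (auto simp: in_language_def Fm_def)
    qed
  qed
qed

lemma extends_to_weaken:
  "extends_to JL CS G' D' P \<Longrightarrow> G \<subseteq> G' \<Longrightarrow> D \<subseteq> D' \<Longrightarrow>
   (\<And>G D. P G D \<Longrightarrow> Q G D) \<Longrightarrow> extends_to JL CS G D Q"
  unfolding extends_to_def by (meson order_trans)

lemma extends_to_dutyL:
  assumes CS: "constant_spec JL CS" and op: "open_branch JL CS G D" and "\<phi> \<in> G" and sub: "G0 \<subseteq> G"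
  shows "extends_to JL CS G D (dutyL (atom_closure JL CS G0) v \<phi>)"
proof (cases "\<exists>w t A. \<phi> = Frc w (Just t A) \<and> Rel w v \<in> atom_closure JL CS G0")
  case True
  then obtain w t A where \<phi>: "\<phi> = Frc w (Just t A)" and rel: "Rel w v \<in> atom_closure JL CS G0"
    by blast
  obtain G' where G': "G \<subseteq> G'" "Rel w v \<in> G'" "open_branch JL CS G' D"
    using extends_to_closure[OF rel CS sub op] by blast
  have \<phi>G': "Frc w (Just t A) \<in> G'" using \<phi> assms(3) G'(1) by blast
  have "lfm_in JL (Frc w (Just t A))" by (rule open_branch_in_language[OF G'(3) \<phi>G']) simp
  then have "open_branch JL CS (insert (Frc v A) G') D"
    by (intro open_branch_insert_from_two[OF G'(3) _ \<phi>G' _ G'(2) _ _ G3.LJust])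
      (simp_all add: Fm_def Tm_def)
  then have "extends_to JL CS (insert (Frc v A) G') D (dutyL (atom_closure JL CS G0) v \<phi>)"
    by (rule extends_to_refl) (simp add: \<phi>)
  then show ?thesis by (rule extends_to_weaken) (use G'(1) in auto)
next
  case False
  show ?thesis
  proof (cases "\<exists>w C. \<phi> = Frc w C \<and>
      ((\<exists>A. C = Neg A) \<or> (\<exists>A B. C = And A B \<or> C = Or A B \<or> C = Imp A B))")
    case True
    then obtain w C where \<phi>: "\<phi> = Frc w C"
      and C: "(\<exists>A. C = Neg A) \<or> (\<exists>A B. C = And A B \<or> C = Or A B \<or> C = Imp A B)" by blast
    show ?thesis
      using C by (intro extends_to_weaken[OF extends_to_reducedL[OF op assms(3)[unfolded \<phi>] C]])
        (auto simp: \<phi>)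
  next
    case False
    with \<open>\<not> (\<exists>w t A. _ w t A)\<close> have "dutyL (atom_closure JL CS G0) v \<phi> G D"
      by (induction "atom_closure JL CS G0" v \<phi> G D rule: dutyL.induct) auto
    then show ?thesis using op by (intro extends_to_refl)
  qed
qed

lemma extends_to_dutyR:
  assumes CS: "constant_spec JL CS" and op: "open_branch JL CS G D" and "\<phi> \<in> D" and sub: "G0 \<subseteq> G"
  shows "extends_to JL CS G D (dutyR (atom_closure JL CS G0) \<phi>)"
proof (cases "\<exists>w t A. \<phi> = Frc w (Just t A) \<and> Ev w t A \<in> atom_closure JL CS G0")
  case True
  then obtain w t A where \<phi>: "\<phi> = Frc w (Just t A)" and ev: "Ev w t A \<in> atom_closure JL CS G0"
    by blast
  obtain G' where G': "G \<subseteq> G'" "Ev w t A \<in> G'" "open_branch JL CS G' D"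
    using extends_to_closure[OF ev CS sub op] by blast
  have "extends_to JL CS G' D (\<lambda>G D. reducedR G D (Frc w (Just t A)))"
    using G'(2) assms(3) \<phi> by (intro extends_to_reducedR[OF G'(3)]) auto
  then show ?thesis using G'(1) by (rule extends_to_weaken) (auto simp: \<phi>)
next
  case False
  show ?thesis
  proof (cases "\<exists>w C. \<phi> = Frc w C \<and>
      ((\<exists>A. C = Neg A) \<or> (\<exists>A B. C = And A B \<or> C = Or A B \<or> C = Imp A B))")
    case True
    then obtain w C where \<phi>: "\<phi> = Frc w C"
      and C: "(\<exists>A. C = Neg A) \<or> (\<exists>A B. C = And A B \<or> C = Or A B \<or> C = Imp A B)" by blast
    have "extends_to JL CS G D (\<lambda>G D. reducedR G D (Frc w C))"
      using C assms(3) \<phi> by (intro extends_to_reducedR[OF op]) auto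
    then show ?thesis using C by (elim extends_to_weaken) (auto simp: \<phi>)
  next
    case False
    with \<open>\<not> (\<exists>w t A. _ w t A)\<close> have "dutyR (atom_closure JL CS G0) \<phi> G D"
      by (induction "atom_closure JL CS G0" \<phi> G D rule: dutyR.induct) auto
    then show ?thesis using op by (intro extends_to_refl)
  qed
qed

lemma extends_to_successor:
  assumes "has_jD JL" and op: "open_branch JL CS G D"
  shows "extends_to JL CS G D (\<lambda>G D. \<exists>v. Rel w v \<in> G)"
proof -
  obtain \<Gamma> \<Delta> where top: "branch_top JL CS \<Gamma> \<Delta> G D"
    using op by (auto simp: open_branch_def)
  obtain v where "v \<notin> labels \<Gamma>" "v \<notin> labels \<Delta>" using fresh_label by blast
  then have n: "\<not> G3 JL CS (add_mset (Rel w v) \<Gamma>) \<Delta>"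
    using G3.Ser[OF assms(1)] top unfolding branch_top_def by blast
  show ?thesis
    using top by (intro extends_to_if_top[OF top n]) (auto simp: branch_top_def in_language_def)
qed

text \<open>Finitely many duties can be met one after the other because continuing the branch never undoes
  what was achieved.\<close>

lemma extends_to_all:
  assumes "finite I" and op: "open_branch JL CS G D"
    and mono: "\<And>i G D G' D'. P i G D \<Longrightarrow> G \<subseteq> G' \<Longrightarrow> D \<subseteq> D' \<Longrightarrow> P i G' D'"
    and each: "\<And>i G' D'. i \<in> I \<Longrightarrow> G \<subseteq> G' \<Longrightarrow> D \<subseteq> D' \<Longrightarrow> open_branch JL CS G' D' \<Longrightarrow>
      extends_to JL CS G' D' (P i)"
  shows "extends_to JL CS G D (\<lambda>G D. \<forall>i\<in>I. P i G D)"
  using assms(1) each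
proof (induction I rule: finite_induct)
  case empty
  then show ?case using op by (simp add: extends_to_refl)
next
  case (insert i I)
  then obtain G1 D1 where 1: "G \<subseteq> G1" "D \<subseteq> D1" "open_branch JL CS G1 D1" "\<forall>i\<in>I. P i G1 D1"
    unfolding extends_to_def by (metis insertCI)
  then obtain G2 D2 where "G1 \<subseteq> G2" "D1 \<subseteq> D2" "open_branch JL CS G2 D2" "P i G2 D2"
    using insert.prems[of i G1 D1] unfolding extends_to_def by blast
  then show ?case using 1 mono unfolding extends_to_def by (metis insertE order_trans)
qed

text \<open>One round of the search. In round \<open>n\<close> only labels up to \<open>n\<close> are considered for (L:) and only
  the label \<open>n\<close> for (Ser), which keeps the round finite; every label gets its turn, whether or not
  it occurs on the branch, since every label will be a world.\<close>

definition stage :: "logic \<Rightarrow> ('p, 'x, 'c) fm set \<Rightarrow> nat \<Rightarrow> ('p, 'x, 'c) lfm set \<Rightarrow>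
    ('p, 'x, 'c) lfm set \<Rightarrow> ('p, 'x, 'c) lfm set \<Rightarrow> ('p, 'x, 'c) lfm set \<Rightarrow> bool" where
  "stage JL CS n G D G' D' \<longleftrightarrow> G \<subseteq> G' \<and> D \<subseteq> D' \<and>
     (\<forall>\<phi>\<in>G. \<forall>v\<le>n. dutyL (atom_closure JL CS G) v \<phi> G' D') \<and>
     (\<forall>\<phi>\<in>D. dutyR (atom_closure JL CS G) \<phi> G' D') \<and>
     (has_jD JL \<longrightarrow> (\<exists>v. Rel n v \<in> G'))"

lemma stage_exists:
  assumes CS: "constant_spec JL CS" and op: "open_branch JL CS G D"
  shows "\<exists>G' D'. open_branch JL CS G' D' \<and> stage JL CS n G D G' D'"
proof -
  let ?K = "atom_closure JL CS G"
  have fin: "finite G" "finite D" using op by (auto simp: open_branch_def branch_top_def)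
  have "extends_to JL CS G D (\<lambda>G' D'. \<forall>i\<in>G \<times> {..n}. dutyL ?K (snd i) (fst i) G' D')"
    using fin op dutyL_mono CS by (intro extends_to_all extends_to_dutyL) (auto, blast+)
  then obtain G1 D1 where 1: "G \<subseteq> G1" "D \<subseteq> D1" "open_branch JL CS G1 D1"
      "\<forall>\<phi>\<in>G. \<forall>v\<le>n. dutyL ?K v \<phi> G1 D1"
    unfolding extends_to_def by fastforce
  have "extends_to JL CS G1 D1 (\<lambda>G' D'. \<forall>\<phi>\<in>D. dutyR ?K \<phi> G' D')"
    using fin 1 dutyR_mono CS by (intro extends_to_all extends_to_dutyR) (auto, blast+)
  then obtain G2 D2 where 2: "G1 \<subseteq> G2" "D1 \<subseteq> D2" "open_branch JL CS G2 D2"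
      "\<forall>\<phi>\<in>D. dutyR ?K \<phi> G2 D2"
    unfolding extends_to_def by fastforce
  have "extends_to JL CS G2 D2 (\<lambda>G' D'. has_jD JL \<longrightarrow> (\<exists>v. Rel n v \<in> G'))"
    using extends_to_successor[OF _ 2(3)] extends_to_refl[OF 2(3)]
    by (cases "has_jD JL") auto
  then obtain G3 D3 where 3: "G2 \<subseteq> G3" "D2 \<subseteq> D3" "open_branch JL CS G3 D3"
      "has_jD JL \<longrightarrow> (\<exists>v. Rel n v \<in> G3)"
    unfolding extends_to_def by blast
  have "stage JL CS n G D G3 D3"
    unfolding stage_def using 1 2 3 dutyL_mono[of ?K _ _ G1 D1 G3 D3] dutyR_mono[of ?K _ G2 D2 G3 D3]
    by auto
  then show ?thesis using 3 by blast
qed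

section \<open>Saturated branches\<close>

definition saturated :: "logic \<Rightarrow> ('p, 'x, 'c) fm set \<Rightarrow> ('p, 'x, 'c) lfm set \<Rightarrow>
    ('p, 'x, 'c) lfm set \<Rightarrow> bool" where
  "saturated JL CS G D \<longleftrightarrow>
     (\<forall>\<phi>\<in>G. \<forall>v. dutyL (atom_closure JL CS G) v \<phi> G D) \<and>
     (\<forall>\<phi>\<in>D. dutyR (atom_closure JL CS G) \<phi> G D) \<and>
     (\<forall>w. Frc w Bot \<notin> G) \<and>
     (\<forall>\<phi>\<in>atom_closure JL CS G. atomic \<phi> \<longrightarrow> \<phi> \<notin> D) \<and>
     (has_jD JL \<longrightarrow> (\<forall>w. \<exists>v. Rel w v \<in> G))"

text \<open>The union of the rounds. A duty on a formula is met in any round \<open>n\<close> that is late enough for the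
  formula to be present, for the relevant atom to be in the closure, and for the label in question
  to be at most \<open>n\<close>.\<close>

lemma open_branch_saturates:
  assumes CS: "constant_spec JL CS" and "open_branch JL CS G0 D0"
  shows "\<exists>G D. G0 \<subseteq> G \<and> D0 \<subseteq> D \<and> saturated JL CS G D"
proof -
  have "\<exists>f. \<forall>n. ((open_branch JL CS (fst (f n)) (snd (f n)) \<and> (n = 0 \<longrightarrow> f n = (G0, D0))) \<and>
      stage JL CS n (fst (f n)) (snd (f n)) (fst (f (Suc n))) (snd (f (Suc n))))"
    using assms(2) stage_exists[OF CS] by (intro dependent_nat_choice) auto
  then obtain f where f: "\<And>n. open_branch JL CS (fst (f n)) (snd (f n))" "f 0 = (G0, D0)"
      "\<And>n. stage JL CS n (fst (f n)) (snd (f n)) (fst (f (Suc n))) (snd (f (Suc n)))"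
    by blast
  define G D where "G n = fst (f n)" and "D n = snd (f n)" for n
  have op: "open_branch JL CS (G n) (D n)"
    and stage: "stage JL CS n (G n) (D n) (G (Suc n)) (D (Suc n))" for n
    using f by (auto simp: G_def D_def)
  have start: "G 0 = G0" "D 0 = D0" using f(2) by (auto simp: G_def D_def)
  have Gmono: "G m \<subseteq> G n" if "m \<le> n" for m n
    using that by (rule lift_Suc_mono_le[rotated]) (use stage in \<open>auto simp: stage_def\<close>)
  have Dmono: "D m \<subseteq> D n" if "m \<le> n" for m n
    using that by (rule lift_Suc_mono_le[rotated]) (use stage in \<open>auto simp: stage_def\<close>)
  define G' D' where "G' = (\<Union>n. G n)" and "D' = (\<Union>n. D n)"
  define K where "K = atom_closure JL CS G'"
  have late: "\<exists>m. \<forall>n\<ge>m. \<phi> \<in> G n" if "\<phi> \<in> G'" for \<phi>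
    using that Gmono unfolding G'_def by blast
  have lateD: "\<exists>m. \<forall>n\<ge>m. \<phi> \<in> D n" if "\<phi> \<in> D'" for \<phi>
    using that Dmono unfolding D'_def by blast
  have lateK: "\<exists>m. \<forall>n\<ge>m. \<phi> \<in> atom_closure JL CS (G n)" if "\<phi> \<in> K" for \<phi>
  proof -
    have "\<exists>m. \<phi> \<in> atom_closure JL CS (G m)"
      using that unfolding K_def G'_def by (rule atom_closure_UN_chain) (rule Gmono)
    then show ?thesis using atom_closure_mono Gmono by blast
  qed
  have sub: "G n \<subseteq> G'" "D n \<subseteq> D'" for n unfolding G'_def D'_def by auto
  have dutyL: "dutyL K v \<phi> G' D'" if \<phi>: "\<phi> \<in> G'" for v \<phi>
  proof -
    obtain m where m: "\<And>w t A n. \<phi> = Frc w (Just t A) \<Longrightarrow> Rel w v \<in> K \<Longrightarrow> m \<le> n \<Longrightarrow>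
        Rel w v \<in> atom_closure JL CS (G n)"
    proof (cases "\<exists>w t A. \<phi> = Frc w (Just t A) \<and> Rel w v \<in> K")
      case True
      then obtain w t A where "\<phi> = Frc w (Just t A)" "Rel w v \<in> K" by blast
      then show thesis using lateK[of "Rel w v"] that by fastforce
    next
      case False
      then show thesis using that by blast
    qed
    obtain k where k: "\<forall>n\<ge>k. \<phi> \<in> G n" using late[OF \<phi>] by blast
    define n where "n = max v (max m k)"
    have n: "v \<le> n" "m \<le> n" "\<phi> \<in> G n" using k by (auto simp: n_def)
    have "dutyL (atom_closure JL CS (G n)) v \<phi> (G (Suc n)) (D (Suc n))"
      using stage[of n] n unfolding stage_def by blast
    then have "dutyL (atom_closure JL CS (G n)) v \<phi> G' D'"
      using sub by (rule dutyL_mono)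
    then show ?thesis
      by (rule dutyL_transfer) (use m n(2) in blast)
  qed
  have dutyR: "dutyR K \<phi> G' D'" if \<phi>: "\<phi> \<in> D'" for \<phi>
  proof -
    obtain m where m: "\<And>w t A n. \<phi> = Frc w (Just t A) \<Longrightarrow> Ev w t A \<in> K \<Longrightarrow> m \<le> n \<Longrightarrow>
        Ev w t A \<in> atom_closure JL CS (G n)"
    proof (cases "\<exists>w t A. \<phi> = Frc w (Just t A) \<and> Ev w t A \<in> K")
      case True
      then obtain w t A where "\<phi> = Frc w (Just t A)" "Ev w t A \<in> K" by blast
      then show thesis using lateK[of "Ev w t A"] that by fastforce
    next
      case False
      then show thesis using that by blast
    qed
    obtain k where k: "\<forall>n\<ge>k. \<phi> \<in> D n" using lateD[OF \<phi>] by blast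
    define n where "n = max m k"
    have n: "m \<le> n" "\<phi> \<in> D n" using k by (auto simp: n_def)
    have "dutyR (atom_closure JL CS (G n)) \<phi> (G (Suc n)) (D (Suc n))"
      using stage[of n] n unfolding stage_def by blast
    then have "dutyR (atom_closure JL CS (G n)) \<phi> G' D'"
      using sub by (rule dutyR_mono)
    then show ?thesis
      by (rule dutyR_transfer) (use m n(1) in blast)
  qed
  have "\<phi> \<notin> D'" if \<phi>: "\<phi> \<in> K" "atomic \<phi>" for \<phi>
  proof
    assume "\<phi> \<in> D'"
    then obtain m k where "\<forall>n\<ge>m. \<phi> \<in> D n" "\<forall>n\<ge>k. \<phi> \<in> atom_closure JL CS (G n)"
      using lateD lateK[OF \<phi>(1)] by blast
    then show False using open_branch_no_clash[OF CS op[of "max m k"] _ \<phi>(2)] by auto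
  qed
  moreover have "Frc w Bot \<notin> G'" for w
    using open_branch_no_Bot[OF op] unfolding G'_def by blast
  moreover have "\<exists>v. Rel w v \<in> G'" if "has_jD JL" for w
    using that stage[of w] sub unfolding stage_def by blast
  ultimately have "saturated JL CS G' D'"
    using dutyL dutyR unfolding saturated_def K_def by blast
  then show ?thesis using sub[of 0] start by auto
qed

section \<open>The countermodel of a saturated branch\<close>

definition branch_model :: "('p, 'x, 'c) lfm set \<Rightarrow> ('p, 'x, 'c, nat) model" where
  "branch_model K = \<lparr>worlds = UNIV, acc = {(w, v). Rel w v \<in> K},
     evid = (\<lambda>t A. {w. Ev w t A \<in> K}), val = (\<lambda>p. {w. Frc w (Atom p) \<in> K})\<rparr>"

text \<open>The closure rules are the conditions on Fitting models; only seriality must come from the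
  branch, because (Ser) introduces a fresh label.\<close>

lemma fitting_model_branch_model:
  assumes "has_jD JL \<Longrightarrow> \<forall>w. \<exists>v. Rel w v \<in> X"
  shows "fitting_model JL CS (branch_model (atom_closure JL CS X))"
  using assms unfolding fitting_model_def branch_model_def
  by (auto simp: refl_on_def intro: atom_closure.intros intro!: transI)

lemma Frc_atom_closure_iff: "Frc w A \<in> atom_closure JL CS X \<longleftrightarrow> Frc w A \<in> X"
  by (auto elim: atom_closure.cases intro: atom_closure.base)

text \<open>For \<open>t:A\<close> on the left, the evidence comes from closure under (E), and \<open>A\<close> is forced at all
  accessible labels because (L:) was applied to each of them. For \<open>t:A\<close> on the right, either
  the evidence is missing, or (R:) has put \<open>A\<close> on the right at some accessible label.\<close>

lemma saturated_truth:
  assumes sat: "saturated JL CS G D"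
  defines "M \<equiv> branch_model (atom_closure JL CS G)"
  shows "(Frc w A \<in> G \<longrightarrow> forces M w A) \<and> (Frc w A \<in> D \<longrightarrow> \<not> forces M w A)"
proof -
  define K where "K = atom_closure JL CS G"
  have dutyL: "dutyL K v \<phi> G D" if "\<phi> \<in> G" for v \<phi>
    using sat that by (simp add: saturated_def K_def)
  have dutyR: "dutyR K \<phi> G D" if "\<phi> \<in> D" for \<phi>
    using sat that by (simp add: saturated_def K_def)
  have GK: "G \<subseteq> K" unfolding K_def by (auto intro: atom_closure.base)
  have "(Frc w A \<in> G \<longrightarrow> forces (branch_model K) w A) \<and>
      (Frc w A \<in> D \<longrightarrow> \<not> forces (branch_model K) w A)"
  proof (induction A arbitrary: w)
    case (Atom p)
    have "Frc w (Atom p) \<in> K \<longleftrightarrow> Frc w (Atom p) \<in> G" by (simp add: K_def Frc_atom_closure_iff)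
    moreover have "Frc w (Atom p) \<notin> D" if "Frc w (Atom p) \<in> K"
      using sat that by (auto simp: saturated_def K_def)
    ultimately show ?case by (auto simp: branch_model_def)
  next
    case Bot
    then show ?case using sat by (simp add: saturated_def)
  next
    case (Just t A)
    show ?case
    proof (intro conjI impI)
      assume J: "Frc w (Just t A) \<in> G"
      have "Ev w t A \<in> K" unfolding K_def using J by (intro atom_closure.intros)
      moreover have "forces (branch_model K) v A" if "Rel w v \<in> K" for v
        using dutyL[OF J, of v] that Just.IH by simp
      ultimately show "forces (branch_model K) w (Just t A)"
        by (simp add: branch_model_def)
    next
      assume J: "Frc w (Just t A) \<in> D"
      show "\<not> forces (branch_model K) w (Just t A)"
      proof (cases "Ev w t A \<in> K")
        case True
        then obtain v where "Rel w v \<in> G" "Frc v A \<in> D" using dutyR[OF J] by auto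
        then show ?thesis using Just.IH[of v] GK by (auto simp: branch_model_def)
      next
        case False
        then show ?thesis by (simp add: branch_model_def)
      qed
    qed
  qed (use dutyL dutyR in fastforce)+
  then show ?thesis unfolding M_def K_def .
qed

theorem theorem8p2:
  fixes JL :: logic
    and CS :: "('p, 'x, 'c) fm set"
    and \<Gamma> \<Delta> :: "('p, 'x, 'c) lfm multiset"
  assumes "constant_spec JL CS" and "finite CS"
    and "in_language JL \<Gamma>" and "in_language JL \<Delta>"
  shows "G3 JL CS \<Gamma> \<Delta> \<or> (\<exists>M :: ('p, 'x, 'c, nat) model. countermodel JL CS M \<Gamma> \<Delta>)"
proof (cases "G3 JL CS \<Gamma> \<Delta>")
  case True
  then show ?thesis ..
next
  case False
  obtain G D where sub: "set_mset \<Gamma> \<subseteq> G" "set_mset \<Delta> \<subseteq> D" and sat: "saturated JL CS G D"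
    using open_branch_saturates[OF assms(1) open_branch_initial[OF False assms(3,4)]] by blast
  define K where "K = atom_closure JL CS G"
  note truth = saturated_truth[OF sat, folded K_def]
  have "fitting_model JL CS (branch_model K)"
    using sat unfolding K_def by (intro fitting_model_branch_model) (simp add: saturated_def)
  moreover have "validates (branch_model K) id \<phi>" if "\<phi> \<in># \<Gamma>" for \<phi>
  proof -
    have "\<phi> \<in> G" using that sub by blast
    moreover from this have "\<phi> \<in> K" unfolding K_def by (rule atom_closure.base)
    ultimately show ?thesis using truth by (cases \<phi>) (auto simp: branch_model_def)
  qed
  moreover have "\<not> validates (branch_model K) id \<phi>" if "\<phi> \<in># \<Delta>" for \<phi>
  proof -
    have "\<phi> \<in> D" using that sub by blast
    moreover from this have "\<phi> \<notin> K" if "atomic \<phi>"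
      using sat that by (auto simp: saturated_def K_def)
    ultimately show ?thesis using truth by (cases \<phi>) (auto simp: branch_model_def)
  qed
  ultimately have "countermodel JL CS (branch_model K) \<Gamma> \<Delta>"
    unfolding countermodel_def by (intro conjI exI[of _ id]) (auto simp: branch_model_def)
  then show ?thesis by blast
qed

end
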